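(* Let $k\ge1$, fix monomials $f_{i,\sigma,\tau}(q)\in\mathbb{Z}[q]$ for $1\le i\le k$, $\sigma\ge1$, $\tau\ge0$, and use the weighted $k$-Fibonacci polynomials defined in the context. Then for all integers $m\ge1$ and $n\ge1$, $$F_{m+n}^k(\mathbf z;q)=F_m^k(\mathbf z\mathbf s_n^+;q)\,F_n^k(\mathbf z\mathbf s_m^-;q)+\sum_{i=2}^k\sum_{j=1}^{i-1}z_i\,f_{i,m-j+1,n-i+j}(q)\,F_{m-j}^k(\mathbf z\mathbf s^+_{n+j};q)\,F^k_{n-i+j}(\mathbf z\mathbf s^-_{m+i-j};q).$$
   Context: Cells of an $n\times1$ board are numbered $1,\dots,n$. A tiling of the board by tiles of length at most $k$ is a sequence of tiles of lengths $\ell_1,\dots,\ell_r\in\{1,\dots,k\}$ with $\ell_1+\cdots+\ell_r=n$; the $j$-th tile starts at cell $\sigma_j=1+\ell_1+\cdots+\ell_{j-1}$ and is followed by $\tau_j=n-(\sigma_j+\ell_j-1)$ cells. Let $\mathbf z=(z_1,\dots,z_k)$ be indeterminates. A tile of length $i$ that begins in cell $\sigma$ and is followed by $\tau$ cells has weight $z_i f_{i,\sigma,\tau}(q)$, and the weight of a tiling is the product of the weights of its tiles. For integers $a,b\ge0$ define $$F_n^k[a,b]=\sum \prod_{j=1}^r z_{\ell_j}\,f_{\ell_j,\,a+\sigma_j,\,b+\tau_j}(q),$$ the sum over all tilings of the $n\times1$ board by tiles of length at most $k$ (the weighted count of tilings of an $n\times 1$ board that has an untiled $a\times1$ board appended before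 it and an untiled $b\times1$ board appended after it). By convention $F_0^k[a,b]=1$ and $F_n^k[a,b]=0$ for $n<0$. Notation: $F_n^k(\mathbf z;q)=F_n^k[0,0]$, $F_n^k(\mathbf z\mathbf s^+_m;q)=F_n^k[0,m]$, and $F_n^k(\mathbf z\mathbf s^-_m;q)=F_n^k[m,0]$. *)

theory Defs
  imports
    "HOL-Computational_Algebra.Polynomial"
    "HOL-Library.Poly_Mapping"
begin

text \<open>
  Polynomials over \<open>\<int>[q]\<close> (the type \<open>int poly\<close>) in indeterminates \<open>z\<^sub>i\<close>; exponent vectors are
  the finitely supported maps \<open>int \<Rightarrow>\<^sub>0 nat\<close>. Only \<open>z\<^sub>1, \<dots>, z\<^sub>k\<close> occur below. Cell numbers, lengths
  and shifts are all of type \<open>int\<close>, so that no subtraction is truncated.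
\<close>

type_synonym zpoly = "(int \<Rightarrow>\<^sub>0 nat) \<Rightarrow>\<^sub>0 int poly"

definition zvar :: "int \<Rightarrow> zpoly" where
  "zvar i = Poly_Mapping.single (Poly_Mapping.single i 1) 1"

definition zconst :: "int poly \<Rightarrow> zpoly" where
  "zconst p = Poly_Mapping.single 0 p"

definition is_monomial :: "int poly \<Rightarrow> bool" where
  "is_monomial p \<longleftrightarrow> (\<exists>c e. p = monom c e)"

definition tilings :: "int \<Rightarrow> int \<Rightarrow> int list set" where
  "tilings k n = {ls. set ls \<subseteq> {1..k} \<and> sum_list ls = n}"

text \<open>List positions count from 0, so \<open>tile_start ls j\<close> is the paper's \<open>\<sigma>\<close> for tile number \<open>j + 1\<close>.\<close>

definition tile_start :: "int list \<Rightarrow> nat \<Rightarrow> int" where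
  "tile_start ls j = 1 + sum_list (take j ls)"

definition tile_after :: "int \<Rightarrow> int list \<Rightarrow> nat \<Rightarrow> int" where
  "tile_after n ls j = n - (tile_start ls j + ls ! j - 1)"

definition wfib :: "(int \<Rightarrow> int \<Rightarrow> int \<Rightarrow> int poly) \<Rightarrow> int \<Rightarrow> int \<Rightarrow> int \<Rightarrow> int \<Rightarrow> zpoly" where
  "wfib f k n a b =
     (\<Sum>ls\<in>tilings k n. \<Prod>j<length ls.
        zvar (ls ! j) * zconst (f (ls ! j) (a + tile_start ls j) (b + tile_after n ls j)))"

text \<open>\<open>F\<^sub>n\<^sup>k(z; q)\<close>, \<open>F\<^sub>n\<^sup>k(z s\<^sup>+\<^sub>m; q)\<close> and \<open>F\<^sub>n\<^sup>k(z s\<^sup>-\<^sub>m; q)\<close>, in this order.\<close>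

abbreviation (input) wfib_std where "wfib_std f k n \<equiv> wfib f k n 0 0"
abbreviation (input) wfib_plus where "wfib_plus f k n m \<equiv> wfib f k n 0 m"
abbreviation (input) wfib_minus where "wfib_minus f k n m \<equiv> wfib f k n m 0"

text \<open>The sum in \<open>wfib\<close> is over a finite set, and the conventions for \<open>n \<le> 0\<close> hold.\<close>

lemma length_le_sum_list:
  fixes ls :: "int list"
  shows "set ls \<subseteq> {1..k} \<Longrightarrow> int (length ls) \<le> sum_list ls"
  by (induction ls) auto

lemma finite_tilings: "finite (tilings k n)"
proof (rule finite_subset)
  show "tilings k n \<subseteq> {ls. set ls \<subseteq> {1..k} \<and> length ls \<le> nat n}"
    using length_le_sum_list by (fastforce simp: tilings_def)
  show "finite {ls. set ls \<subseteq> {1..k} \<and> length ls \<le> nat n}"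
    by (rule finite_lists_length_le) simp
qed

lemma wfib_0: "wfib f k 0 a b = 1"
proof -
  have "tilings k 0 = {[]}"
    using length_le_sum_list by (fastforce simp: tilings_def)
  then show ?thesis by (simp add: wfib_def)
qed

lemma wfib_neg: "n < 0 \<Longrightarrow> wfib f k n a b = 0"
proof -
  assume "n < 0"
  then have "tilings k n = {}"
    using length_le_sum_list by (fastforce simp: tilings_def)
  then show ?thesis by (simp add: wfib_def)
qed

end

theory Submission
  imports Defs
begin

text \<open>
  A tiling of \<open>m + n\<close> cells either breaks after cell \<open>m\<close>, which gives the product term, or has a
  unique tile of some length \<open>i\<close> that covers both cells \<open>m\<close> and \<open>m + 1\<close>, with exactly \<open>j\<close> of its
  cells among the first \<open>m\<close>. The identity is obtained, for arbitrary shifts \<open>a\<close> and \<open>b\<close>, by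
  induction on \<open>m\<close>: splitting off the first tile gives a recurrence that acts on both sides in
  the same way, except when the first tile itself crosses the break (\<open>j = m\<close>).
\<close>

definition tile_weight :: "(int \<Rightarrow> int \<Rightarrow> int \<Rightarrow> int poly) \<Rightarrow> int \<Rightarrow> int \<Rightarrow> int \<Rightarrow> zpoly" where
  "tile_weight f l s t = zvar l * zconst (f l s t)"

lemma tilings_unfold:
  assumes "n > 0"
  shows "tilings k n = (\<Union>l\<in>{1..k}. (#) l ` tilings k (n - l))"
proof (rule set_eqI)
  fix ls
  show "ls \<in> tilings k n \<longleftrightarrow> ls \<in> (\<Union>l\<in>{1..k}. (#) l ` tilings k (n - l))"
    using assms by (cases ls) (auto simp: tilings_def image_iff)
qed

text \<open>Tilings are sorted by their first tile. Behind a first tile of length \<open>l\<close>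
  the remaining tiles have \<open>l\<close> more cells in front, so \<open>a\<close> becomes
  \<open>a + l\<close>, while \<open>b\<close> stays.\<close>

lemma wfib_rec_pos:
  assumes "n > 0"
  shows "wfib f k n a b =
    (\<Sum>l=1..k. tile_weight f l (a + 1) (b + n - l) * wfib f k (n - l) (a + l) b)"
proof -
  define g where "g n a ls = (\<Prod>j<length ls.
      tile_weight f (ls ! j) (a + tile_start ls j) (b + tile_after n ls j))" for n a ls
  have wfib_g: "wfib f k n a b = (\<Sum>ls\<in>tilings k n. g n a ls)" for n a
    by (simp add: wfib_def g_def tile_weight_def)
  have g_Cons: "g n a (l # ls) = tile_weight f l (a + 1) (b + n - l) * g (n - l) (a + l) ls" for l ls
    by (simp add: g_def prod.lessThan_Suc_shift tile_start_def tile_after_def algebra_simps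
        del: prod.lessThan_Suc)
  have "wfib f k n a b = (\<Sum>l=1..k. \<Sum>ls\<in>(#) l ` tilings k (n - l). g n a ls)"
    unfolding wfib_g tilings_unfold[OF assms]
    by (rule sum.UNION_disjoint) (auto simp: finite_tilings)
  also have "\<dots> = (\<Sum>l=1..k. \<Sum>ls\<in>tilings k (n - l). g n a (l # ls))"
    by (simp add: sum.reindex)
  also have "\<dots> = (\<Sum>l=1..k. tile_weight f l (a + 1) (b + n - l) * wfib f k (n - l) (a + l) b)"
    by (simp add: g_Cons wfib_g sum_distrib_left)
  finally show ?thesis .
qed

text \<open>The indicator accounts for the empty tiling at \<open>n = 0\<close>; for
  \<open>n \<le> 0\<close> every summand has a board of negative length. This form is applied below
  to \<open>m - j\<close>, whose sign is unknown.\<close>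

lemma wfib_rec:
  "wfib f k n a b = (if n = 0 then 1 else 0) +
    (\<Sum>l=1..k. tile_weight f l (a + 1) (b + n - l) * wfib f k (n - l) (a + l) b)"
proof (cases "n > 0")
  case True
  then show ?thesis using wfib_rec_pos[OF True, of f k a b] by simp
next
  case False
  then show ?thesis by (auto simp: wfib_0 wfib_neg intro!: sum.neutral)
qed

lemma wfib_add:
  assumes "m \<ge> 0" "n \<ge> 0"
  shows "wfib f k (m + n) a b =
    wfib f k m a (b + n) * wfib f k n (a + m) b
    + (\<Sum>i=2..k. \<Sum>j=1..i-1.
         tile_weight f i (a + m - j + 1) (b + n - i + j)
         * wfib f k (m - j) a (b + n + j) * wfib f k (n - i + j) (a + m + i - j) b)"
  using assms(1)
proof (induction "nat m" arbitrary: m a rule: less_induct)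
  case less
  show ?case
  proof (cases "m = 0")
    case True
    \<comment> \<open>Every \<open>j \<ge> 1\<close> makes \<open>m - j\<close> negative, so no
      crossing term survives.\<close>
    then show ?thesis by (simp add: wfib_0 wfib_neg)
  next
    case False
    with less.prems have m: "m > 0" by simp
    define w where "w l = tile_weight f l (a + 1) (b + (m + n) - l)" for l
    \<comment> \<open>This is the part of a crossing term that ignores the cells before the crossing
      tile. It involves \<open>a\<close> and \<open>m\<close> only through \<open>a + m\<close>, so
      replacing them by \<open>a + l\<close> and \<open>m - l\<close> leaves it unchanged.\<close>
    define c where "c i j =
      tile_weight f i (a + m - j + 1) (b + n - i + j) * wfib f k (n - i + j) (a + m + i - j) b" for i j
    \<comment> \<open>\<open>S l\<close> is the right-hand side of the claim for
      \<open>m - l\<close> and \<open>a + l\<close>; \<open>X l\<close> collects the tilings whose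
      first tile crosses the break.\<close>
    define S where "S l = wfib f k (m - l) (a + l) (b + n) * wfib f k n (a + m) b
      + (\<Sum>i=2..k. \<Sum>j=1..i-1. c i j * wfib f k (m - j - l) (a + l) (b + n + j))" for l
    define X where "X l = (if l > m then w l * wfib f k (m + n - l) (a + l) b else 0)" for l

    have first_tile: "w l * wfib f k (m + n - l) (a + l) b = w l * S l + X l" if "l \<ge> 1" for l
    proof (cases "l > m")
      case True
      then have "S l = 0"
        by (auto simp: S_def wfib_neg intro!: sum.neutral)
      with True show ?thesis by (simp add: X_def)
    next
      case False
      have "wfib f k ((m - l) + n) (a + l) b = S l"
        using less.hyps[of "m - l" "a + l"] that False m
        by (simp add: S_def c_def algebra_simps)
      then show ?thesis using False by (simp add: X_def algebra_simps)
    qed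

    \<comment> \<open>Only \<open>j = m\<close> contributes, and it lies in the range exactly when
      \<open>i > m\<close>. The crossing tile then starts at \<open>a + 1\<close>, so its weight is
      \<open>w i\<close>. The index \<open>1\<close> may be added because
      \<open>X 1 = 0\<close>.\<close>
    have crossing: "(\<Sum>i=2..k. \<Sum>j=1..i-1. c i j * (if m - j = 0 then 1 else 0)) = (\<Sum>l=1..k. X l)"
    proof -
      have "(\<Sum>j=1..i-1. c i j * (if m - j = 0 then 1 else 0)) = X i" for i
      proof -
        have "(\<Sum>j=1..i-1. c i j * (if m - j = 0 then 1 else 0))
            = (\<Sum>j\<in>{1..i-1}. if m = j then c i j else 0)"
          by (rule sum.cong) auto
        also have "\<dots> = X i"
          using m by (auto simp: X_def c_def w_def algebra_simps)
        finally show ?thesis .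
      qed
      moreover have "(\<Sum>l=2..k. X l) = (\<Sum>l=1..k. X l)"
        using m by (intro sum.mono_neutral_left) (auto simp: X_def)
      ultimately show ?thesis by simp
    qed

    have rec_m: "wfib f k m a (b + n) = (\<Sum>l=1..k. w l * wfib f k (m - l) (a + l) (b + n))"
      using m by (subst wfib_rec_pos) (auto simp: w_def algebra_simps)
    \<comment> \<open>The same \<open>w l\<close> serves for all \<open>j\<close>, since
      \<open>(m - j) + (b + n + j)\<close> does not depend on \<open>j\<close>.\<close>
    have rec_j: "wfib f k (m - j) a (b + n + j) = (if m - j = 0 then 1 else 0)
        + (\<Sum>l=1..k. w l * wfib f k (m - j - l) (a + l) (b + n + j))" for j
      by (subst wfib_rec) (simp add: w_def algebra_simps)

    have "(\<Sum>i=2..k. \<Sum>j=1..i-1. c i j * (\<Sum>l=1..k. w l * wfib f k (m - j - l) (a + l) (b + n + j)))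
        = (\<Sum>i=2..k. \<Sum>l=1..k. \<Sum>j=1..i-1. w l * (c i j * wfib f k (m - j - l) (a + l) (b + n + j)))"
      by (simp add: sum_distrib_left mult.left_commute sum.swap[of _ "{1..k}"])
    also have "\<dots> = (\<Sum>l=1..k. w l *
        (\<Sum>i=2..k. \<Sum>j=1..i-1. c i j * wfib f k (m - j - l) (a + l) (b + n + j)))"
      by (subst sum.swap) (simp add: sum_distrib_left)
    finally have swap: "(\<Sum>i=2..k. \<Sum>j=1..i-1.
          c i j * (\<Sum>l=1..k. w l * wfib f k (m - j - l) (a + l) (b + n + j))) = \<dots>" .

    have "wfib f k (m + n) a b = (\<Sum>l=1..k. w l * wfib f k (m + n - l) (a + l) b)"
      using m assms(2) by (subst wfib_rec_pos) (auto simp: w_def)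
    also have "\<dots> = (\<Sum>l=1..k. w l * S l) + (\<Sum>l=1..k. X l)"
      by (simp add: first_tile sum.distrib)
    also have "(\<Sum>l=1..k. w l * S l) =
        wfib f k m a (b + n) * wfib f k n (a + m) b
        + (\<Sum>i=2..k. \<Sum>j=1..i-1.
            c i j * (\<Sum>l=1..k. w l * wfib f k (m - j - l) (a + l) (b + n + j)))"
      by (simp only: S_def rec_m swap distrib_left sum.distrib sum_distrib_right mult.assoc)
    also have "\<dots> + (\<Sum>l=1..k. X l) = wfib f k m a (b + n) * wfib f k n (a + m) b
        + (\<Sum>i=2..k. \<Sum>j=1..i-1. c i j * wfib f k (m - j) a (b + n + j))"
      unfolding crossing[symmetric] rec_j distrib_left sum.distrib by (simp only: add_ac)
    finally show ?thesis
      by (simp only: c_def ac_simps)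
  qed
qed

theorem theorem2p2:
  fixes k m n :: int and f :: "int \<Rightarrow> int \<Rightarrow> int \<Rightarrow> int poly"
  assumes "k \<ge> 1"
    and "\<And>i \<sigma> \<tau>. 1 \<le> i \<Longrightarrow> i \<le> k \<Longrightarrow> \<sigma> \<ge> 1 \<Longrightarrow> \<tau> \<ge> 0 \<Longrightarrow> is_monomial (f i \<sigma> \<tau>)"
    and "m \<ge> 1" and "n \<ge> 1"
  shows "wfib_std f k (m + n) =
           wfib_plus f k m n * wfib_minus f k n m
           + (\<Sum>i=2..k. \<Sum>j=1..i-1.
                zvar i * zconst (f i (m - j + 1) (n - i + j))
                * wfib_plus f k (m - j) (n + j) * wfib_minus f k (n - i + j) (m + i - j))"
  using wfib_add[of m n f k 0 0] assms(3,4) by (simp add: tile_weight_def)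

end
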